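(* Let $G\cong\mathbb{Z}_2^r$, of order $v=2^r$, and let $J$ be a proper subgroup of $G$ with $J\cong\mathbb{Z}_2^{r_1}$, of order $t=2^{r_1}$. Let $\lambda,n$ be positive integers. Then there exists a ${}^\lambda\mathrm{NH}_t(1,n)$ over $G$ relative to $J$ if and only if $v=\frac{2n}{\lambda}+t$, $\lambda$ is even, and one of the following holds: (1) $t=2$ (i.e. $r_1=1$) and $n$ is an odd multiple of $v-t$; (2) $v=2$ (i.e. $r=1$, $r_1=0$) and $n$ is odd.
   Context: Groups are written additively. An $m\times n$ partially filled (p.f.) array over $G$ is an $m\times n$ matrix each of whose cells is empty or contains an element of $G$. For a subgroup $J$ of order $t$, a ${}^\lambda\mathrm{NH}_t(m,n;h,k)$ over $G$ relative to $J$ is an $m\times n$ p.f. array $A$ over $G$ such that: (a) each row contains exactly $h$ filled cells and each column exactly $k$ filled cells; (b) the multiset obtained by taking, for every filled cell with entry $x$, both $x$ and $-x$ (with multiplicity, so an involution contributes twice), is exactly the multiset containing each element of $G\setminus J$ exactly $\lambda$ times; (c) each row sum (left to right) and each column sum (top to bottom) is nonzero. ${}^\lambda\mathrm{NH}_t(1,n)$ denotes ${}^\lambda\mathrm{NH}_t(1,n;n,1)$ (a single fully filled row). *)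

theory Defs
  imports
    "HOL-Library.Multiset"
    "HOL-Algebra.Product_Groups"
    "HOL-Algebra.Elementary_Groups"
    "Jordan_Normal_Form.Matrix"
begin

text \<open>Groups use the multiplicative notation of the library: the operation plays the role of
  \<open>+\<close>, \<open>\<one>\<close> that of \<open>0\<close>, and \<open>inv x\<close> that of \<open>-x\<close>.\<close>

definition Z2_power :: "nat \<Rightarrow> (nat \<Rightarrow> int) monoid" where
  "Z2_power r = product_group {..<r} (\<lambda>_. integer_mod_group 2)"

text \<open>A partially filled array is a matrix of options; \<open>None\<close> is an empty cell.\<close>

type_synonym 'a pf_array = "'a option mat"

definition is_pf_array :: "('a, 'b) monoid_scheme \<Rightarrow> nat \<Rightarrow> nat \<Rightarrow> 'a pf_array \<Rightarrow> bool" where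
  "is_pf_array G m n A \<longleftrightarrow>
     A \<in> carrier_mat m n \<and>
     (\<forall>i<m. \<forall>j<n. \<forall>x. A $$ (i, j) = Some x \<longrightarrow> x \<in> carrier G)"

definition filled_cells :: "'a pf_array \<Rightarrow> (nat \<times> nat) set" where
  "filled_cells A = {(i, j). i < dim_row A \<and> j < dim_col A \<and> A $$ (i, j) \<noteq> None}"

definition signed_entries :: "('a, 'b) monoid_scheme \<Rightarrow> 'a pf_array \<Rightarrow> 'a multiset" where
  "signed_entries G A = (\<Sum>c\<in>filled_cells A. {# the (A $$ c), inv\<^bsub>G\<^esub> (the (A $$ c)) #})"

text \<open>The group need not be commutative, so the entries of a line are added up in order,
  skipping the empty cells.\<close>

definition line_sum :: "('a, 'b) monoid_scheme \<Rightarrow> 'a option vec \<Rightarrow> 'a" where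
  "line_sum G w = foldl (\<otimes>\<^bsub>G\<^esub>) \<one>\<^bsub>G\<^esub> (List.map_filter id (list_of_vec w))"

definition is_NH ::
  "('a, 'b) monoid_scheme \<Rightarrow> 'a set \<Rightarrow> nat \<Rightarrow> nat \<Rightarrow> nat \<Rightarrow> nat \<Rightarrow> nat \<Rightarrow> nat \<Rightarrow> 'a pf_array \<Rightarrow> bool"
where
  "is_NH G J lam t m n h k A \<longleftrightarrow>
     subgroup J G \<and> card J = t \<and> is_pf_array G m n A \<and>
     (\<forall>i<m. card {j. (i, j) \<in> filled_cells A} = h) \<and>
     (\<forall>j<n. card {i. (i, j) \<in> filled_cells A} = k) \<and>
     (\<forall>x. count (signed_entries G A) x = (if x \<in> carrier G - J then lam else 0)) \<and>
     (\<forall>i<m. line_sum G (row A i) \<noteq> \<one>\<^bsub>G\<^esub>) \<and>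
     (\<forall>j<n. line_sum G (col A j) \<noteq> \<one>\<^bsub>G\<^esub>)"

abbreviation is_row_NH ::
  "('a, 'b) monoid_scheme \<Rightarrow> 'a set \<Rightarrow> nat \<Rightarrow> nat \<Rightarrow> nat \<Rightarrow> 'a pf_array \<Rightarrow> bool" where
  "is_row_NH G J lam t n A \<equiv> is_NH G J lam t 1 n n 1 A"

end

theory Submission imports Defs begin

text \<open>In an elementary abelian 2-group every entry is its own inverse, so the entries of the array
  form \<open>m = \<lambda> / 2\<close> copies of \<open>G - J\<close> and the row sum is the \<open>m\<close>-th power of the sum of
  \<open>G - J\<close>. If \<open>a \<noteq> \<one>\<close> lies in \<open>J\<close> then pairing \<open>x\<close> with \<open>a \<otimes> x\<close> evaluates that sum
  as the power of \<open>a\<close> with exponent \<open>(v - t) / 2\<close>, which is odd exactly when \<open>t = 2\<close>. If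
  \<open>J\<close> is trivial the same pairing on \<open>G\<close> gives the exponent \<open>v / 2\<close>, which is odd exactly
  when \<open>v = 2\<close>.\<close>

section \<open>Groups of exponent two\<close>

lemma (in group) comm_group_if_square_one:
  assumes "\<And>x. x \<in> carrier G \<Longrightarrow> x \<otimes> x = \<one>"
  shows "comm_group G"
proof (rule group_comm_groupI)
  fix x y assume xy: "x \<in> carrier G" "y \<in> carrier G"
  have "\<And>z. z \<in> carrier G \<Longrightarrow> inv z = z"
    using assms by (simp add: inv_equality)
  then show "x \<otimes> y = y \<otimes> x"
    using xy inv_mult_group[of x y] by simp
qed

lemma Z2_power_square:
  assumes "x \<in> carrier (Z2_power r)"
  shows "x \<otimes>\<^bsub>Z2_power r\<^esub> x = \<one>\<^bsub>Z2_power r\<^esub>"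
proof -
  have "(k + k) mod 2 = 0" for k :: int by presburger
  then show ?thesis
    by (auto simp: Z2_power_def product_group_def integer_mod_group_def fun_eq_iff restrict_def)
qed

lemma (in group) square_one_if_iso_Z2_power:
  assumes iso: "G \<cong> Z2_power r" and x: "x \<in> carrier G"
  shows "x \<otimes> x = \<one>"
proof -
  obtain f where f: "f \<in> iso G (Z2_power r)"
    using iso by (auto simp: is_iso_def)
  have "group (Z2_power r)"
    by (simp add: Z2_power_def)
  then interpret f: group_hom G "Z2_power r" f
    using f by (simp add: group_hom_def group_hom_axioms_def iso_def is_group)
  have inj: "inj_on f (carrier G)"
    using f by (simp add: iso_def bij_betw_def)
  have "f (x \<otimes> x) = f \<one>"
    using x by (simp add: Z2_power_square)
  then show ?thesis
    using inj_onD[OF inj] x by blast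
qed

lemma (in monoid) pow_if_square_one:
  assumes "x \<in> carrier G" "x \<otimes> x = \<one>"
  shows "x [^] (k::nat) = (if odd k then x else \<one>)"
  using assms by (induction k) auto

section \<open>Products over finite sets and lists\<close>

text \<open>Translation by \<open>a\<close> is an involution without fixed points, so
  \<open>S\<close> splits into pairs \<open>{x, a \<otimes> x}\<close>, each with product
  \<open>x \<otimes> a \<otimes> x = a\<close>. The induction removes one pair at a time.\<close>

lemma (in comm_group) finprod_translation_closed:
  assumes sq: "\<And>x. x \<in> carrier G \<Longrightarrow> x \<otimes> x = \<one>"
    and a: "a \<in> carrier G" "a \<noteq> \<one>"
    and S: "finite S" "S \<subseteq> carrier G" "\<And>x. x \<in> S \<Longrightarrow> a \<otimes> x \<in> S"
  shows "(\<Otimes>x\<in>S. x) = a [^] (card S div 2)"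
  using S
proof (induction S rule: finite_psubset_induct)
  case (psubset S)
  show ?case
  proof (cases "S = {}")
    case False
    then obtain x where x: "x \<in> S" by blast
    define T where "T = S - {x, a \<otimes> x}"
    have xc: "x \<in> carrier G" and ax: "a \<otimes> x \<in> S"
      using x psubset.prems by auto
    have cancel: "a \<otimes> (a \<otimes> z) = z" if "z \<in> carrier G" for z
      using sq[OF a(1)] a(1) that by (simp flip: m_assoc)
    have ne: "a \<otimes> x \<noteq> x"
      using a xc by (metis l_one one_closed right_cancel)
    have ST: "S = insert x (insert (a \<otimes> x) T)" "x \<notin> insert (a \<otimes> x) T" "a \<otimes> x \<notin> T"
      using x ax ne by (auto simp: T_def)
    have "finite T" "T \<subset> S" and Tc: "T \<subseteq> carrier G"
      using psubset x by (auto simp: T_def)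
    \<comment> \<open>A translate landing in the removed pair would, after translating back, put
      \<open>z\<close> in that pair.\<close>
    have T_closed: "a \<otimes> z \<in> T" if "z \<in> T" for z
    proof -
      have z: "z \<in> S" "z \<in> carrier G" "z \<noteq> x" "z \<noteq> a \<otimes> x"
        using that psubset.prems by (auto simp: T_def)
      then show ?thesis
        using cancel[OF z(2)] cancel[OF xc] psubset.prems(2)[OF z(1)] by (auto simp: T_def)
    qed
    have IH: "(\<Otimes>x\<in>T. x) = a [^] (card T div 2)"
      using psubset.IH \<open>T \<subset> S\<close> Tc T_closed by blast
    have "(\<Otimes>x\<in>S. x) = x \<otimes> ((a \<otimes> x) \<otimes> (\<Otimes>x\<in>T. x))"
    proof -
      have "(\<Otimes>x\<in>insert (a \<otimes> x) T. x) = (a \<otimes> x) \<otimes> (\<Otimes>x\<in>T. x)"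
        using \<open>finite T\<close> ST(3) Tc a xc by (intro finprod_insert) auto
      moreover have "(\<Otimes>x\<in>S. x) = x \<otimes> (\<Otimes>x\<in>insert (a \<otimes> x) T. x)"
        unfolding ST(1) using \<open>finite T\<close> ST(2) Tc a xc by (intro finprod_insert) auto
      ultimately show ?thesis by simp
    qed
    also have "\<dots> = (x \<otimes> x) \<otimes> (a [^] (card T div 2) \<otimes> a)"
      unfolding IH using a xc by (simp add: m_ac)
    also have "\<dots> = a [^] Suc (card T div 2)"
      using a xc by (simp add: sq)
    also have "Suc (card T div 2) = card S div 2"
      using ST \<open>finite T\<close> by simp
    finally show ?thesis .
  qed simp
qed

text \<open>By commutativity an ordered sum depends only on multiplicities. The index set
  \<open>S\<close> may exceed \<open>set xs\<close>, since elements of count 0 contribute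
  \<open>\<one>\<close>; this allows one fixed \<open>S\<close> for all lists.\<close>

lemma (in comm_monoid) foldl_mult_eq_finprod_count:
  assumes "finite S" "S \<subseteq> carrier G" "set xs \<subseteq> S"
  shows "foldl (\<otimes>) \<one> xs = (\<Otimes>x\<in>S. x [^] count_list xs x)"
  using assms(3)
proof (induction xs rule: rev_induct)
  case Nil
  then show ?case using assms by (simp add: finprod_one_eqI)
next
  case (snoc y xs)
  have y: "y \<in> S" "y \<in> carrier G" using snoc.prems assms by auto
  have "(\<Otimes>x\<in>S. x [^] count_list (xs @ [y]) x)
      = (\<Otimes>x\<in>S. x [^] count_list xs x \<otimes> (if y = x then x else \<one>))"
    using assms by (intro finprod_cong') auto
  also have "\<dots> = (\<Otimes>x\<in>S. x [^] count_list xs x) \<otimes> (\<Otimes>x\<in>S. if y = x then x else \<one>)"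
    using assms by (intro finprod_multf) auto
  also have "(\<Otimes>x\<in>S. if y = x then x else \<one>) = y"
    using finprod_singleton[OF y(1) assms(1), of "\<lambda>x. x"] assms by auto
  finally show ?case using snoc by simp
qed

section \<open>One-row arrays as lists of entries\<close>

lemma sum_add_mset_pair:
  "(\<Sum>j<n. {#f j, f j#}) = mset (map f [0..<n]) + mset (map f [0..<n])"
  by (induction n) auto

lemma map_filter_id_Some: "List.map_filter id (map (\<lambda>j. Some (f j)) js) = map f js"
  by (induction js) auto

text \<open>A row of \<open>n\<close> filled cells is just a list. The factor 2 arises because
  \<open>x\<close> and \<open>inv x\<close> coincide, and the column conditions disappear because
  each column sum is a single entry outside \<open>J\<close>.\<close>

lemma (in group) ex_row_NH_iff_ex_list:
  assumes sq: "\<And>x. x \<in> carrier G \<Longrightarrow> x \<otimes> x = \<one>"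
    and J: "subgroup J G" "card J = t"
  shows "(\<exists>A. is_row_NH G J lam t n A) \<longleftrightarrow>
    (\<exists>xs. length xs = n \<and> set xs \<subseteq> carrier G \<and>
      (\<forall>x. 2 * count_list xs x = (if x \<in> carrier G - J then lam else 0)) \<and>
      foldl (\<otimes>) \<one> xs \<noteq> \<one>)" (is "_ \<longleftrightarrow> (\<exists>xs. ?P xs)")
proof -
  have inv: "inv x = x" if "x \<in> carrier G" for x
    using sq that by (simp add: inv_equality)
  define M where "M f = mat 1 n (\<lambda>(i, j). Some (f j))" for f :: "nat \<Rightarrow> 'a"
  have key: "is_row_NH G J lam t n (M f) \<longleftrightarrow> ?P (map f [0..<n])" for f
  \<comment> \<open>If some entry leaves the carrier, both sides fail; otherwise \<open>inv\<close>
    fixes every entry.\<close>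
  proof (cases "f ` {..<n} \<subseteq> carrier G")
    case False
    then have "\<not> is_pf_array G 1 n (M f)"
      by (auto simp: is_pf_array_def M_def)
    moreover have "\<not> set (map f [0..<n]) \<subseteq> carrier G"
      using False by (auto simp: atLeast0LessThan)
    ultimately show ?thesis unfolding is_NH_def by blast
  next
    case True
    have cells: "filled_cells (M f) = {0} \<times> {..<n}"
      by (auto simp: filled_cells_def M_def)
    have "signed_entries G (M f) = (\<Sum>j<n. {#f j, f j#})"
    proof -
      have "signed_entries G (M f)
          = (\<Sum>j<n. {#the (M f $$ (0, j)), inv (the (M f $$ (0, j)))#})"
        unfolding signed_entries_def cells
        by (rule sum.reindex_bij_witness[of _ "\<lambda>j. (0, j)" snd]) auto
      also have "\<dots> = (\<Sum>j<n. {#f j, f j#})"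
        using True by (intro sum.cong) (auto simp: M_def inv image_subset_iff)
      finally show ?thesis .
    qed
    then have entries: "count (signed_entries G (M f)) x = 2 * count_list (map f [0..<n]) x" for x
      by (simp only: sum_add_mset_pair count_union count_mset mult_2)
    have "list_of_vec (row (M f) 0) = map (\<lambda>j. Some (f j)) [0..<n]"
      by (rule nth_equalityI) (auto simp: M_def list_of_vec_index)
    then have row: "line_sum G (row (M f) 0) = foldl (\<otimes>) \<one> (map f [0..<n])"
      by (simp only: line_sum_def map_filter_id_Some)
    have col: "line_sum G (col (M f) j) = f j" if "j < n" for j
    proof -
      have "list_of_vec (col (M f) j) = map (\<lambda>_. Some (f j)) [0..<1]"
        using that by (intro nth_equalityI) (auto simp: M_def list_of_vec_index)
      then have "line_sum G (col (M f) j) = foldl (\<otimes>) \<one> (map (\<lambda>_. f j) [0..<1])"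
        by (simp only: line_sum_def map_filter_id_Some)
      then show ?thesis using True that by (simp add: image_subset_iff)
    qed
    \<comment> \<open>An entry has positive count, hence lies outside \<open>J\<close>, whereas
      \<open>\<one>\<close> lies in \<open>J\<close>.\<close>
    have col_ne: "f j \<noteq> \<one>"
      if "\<forall>x. 2 * count_list (map f [0..<n]) x = (if x \<in> carrier G - J then lam else 0)" "j < n" for j
    proof -
      have "count_list (map f [0..<n]) (f j) \<noteq> 0"
        using that(2) by (simp add: count_list_0_iff)
      then have "f j \<notin> J" using that(1)[rule_format, of "f j"] by (auto split: if_splits)
      then show ?thesis using subgroup.one_closed[OF J(1)] by auto
    qed
    have rowcard: "card {j. (i, j) \<in> filled_cells (M f)} = n" if "i < 1" for i
      using that by (simp add: cells)
    have colcard: "card {i. (i, j) \<in> filled_cells (M f)} = 1" if "j < n" for j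
      using that by (simp add: cells)
    have pf: "is_pf_array G 1 n (M f)"
      using True by (auto simp: is_pf_array_def M_def)
    show ?thesis
      unfolding is_NH_def entries using J pf rowcard colcard True row col col_ne
      by (auto simp: image_subset_iff)
  qed
  \<comment> \<open>The \<open>n\<close> filled cells of the row lie among \<open>n\<close> columns,
    so no cell is empty.\<close>
  have filled: "A = M (\<lambda>j. the (A $$ (0, j)))" if A: "is_row_NH G J lam t n A" for A
  proof -
    have dim: "A \<in> carrier_mat 1 n" and "card {j. (0, j) \<in> filled_cells A} = n"
      using A by (auto simp: is_NH_def is_pf_array_def)
    moreover have sub: "{j. (0, j) \<in> filled_cells A} \<subseteq> {..<n}"
      using dim by (auto simp: filled_cells_def)
    ultimately have "{j. (0, j) \<in> filled_cells A} = {..<n}"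
      by (intro card_subset_eq) auto
    then have "A $$ (0, j) \<noteq> None" if "j < n" for j
      using that by (auto simp: filled_cells_def)
    then show ?thesis
      using dim by (intro eq_matI) (auto simp: M_def)
  qed
  show ?thesis
  proof
    assume "\<exists>A. is_row_NH G J lam t n A"
    then show "\<exists>xs. ?P xs" using filled key by metis
  next
    assume "\<exists>xs. ?P xs"
    then obtain xs where xs: "?P xs" by blast
    then have "xs = map ((!) xs) [0..<n]" using map_nth[of xs] by simp
    then show "\<exists>A. is_row_NH G J lam t n A" using key xs by metis
  qed
qed

text \<open>Concatenating \<open>m\<close> copies of a repetition-free enumeration of
  \<open>S\<close> supplies the row for the existence direction.\<close>

lemma ex_list_const_count:
  assumes "finite S"
  obtains xs where "set xs \<subseteq> S" "length xs = m * card S"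
    "\<And>x. count_list xs x = (if x \<in> S then m else 0)"
proof -
  obtain ys where ys: "set ys = S" "distinct ys"
    using assms finite_distinct_list by blast
  have "count_list ys x = (if x \<in> S then 1 else 0)" for x
    using distinct_count_atmost_1[of ys] ys by (simp flip: count_mset)
  then have "count_list (concat (replicate m ys)) x = (if x \<in> S then m else 0)" for x
    by (induction m) auto
  moreover have "length (concat (replicate m ys)) = m * card S"
    using ys distinct_card[of ys] by (induction m) auto
  ultimately show thesis
    using that[of "concat (replicate m ys)"] ys by (auto split: if_splits)
qed

text \<open>A constant multiplicity \<open>m\<close> on \<open>carrier G - J\<close> fixes the
  length \<open>n\<close>, and in exponent two the \<open>m\<close>-th powers see only the parity of
  \<open>m\<close>. A nonzero row sum thus separates into a condition on \<open>m\<close> and one on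
  \<open>J\<close>.\<close>

lemma (in comm_group) ex_row_NH_iff_finprod:
  assumes sq: "\<And>x. x \<in> carrier G \<Longrightarrow> x \<otimes> x = \<one>"
    and J: "subgroup J G" "card J = t" "J \<noteq> carrier G" and fin: "finite (carrier G)"
  shows "(\<exists>A. is_row_NH G J lam t n A) \<longleftrightarrow>
    (\<exists>m. lam = 2 * m \<and> n = m * (order G - t) \<and> odd m \<and> (\<Otimes>x\<in>carrier G - J. x) \<noteq> \<one>)"
proof -
  let ?S = "carrier G - J"
  have S: "finite ?S" "?S \<subseteq> carrier G" using fin by auto
  have JG: "J \<subseteq> carrier G" using J(1) subgroup.subset by blast
  have card_S: "card ?S = order G - t"
    using JG J(2) fin by (simp add: card_Diff_subset finite_subset order_def)
  have sum_eq: "foldl (\<otimes>) \<one> xs = (if odd m then \<Otimes>x\<in>?S. x else \<one>)"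
    if "set xs \<subseteq> ?S" "\<And>x. x \<in> ?S \<Longrightarrow> count_list xs x = m" for xs m
  proof -
    have "foldl (\<otimes>) \<one> xs = (\<Otimes>x\<in>?S. x [^] count_list xs x)"
      by (rule foldl_mult_eq_finprod_count[OF S that(1)])
    also have "\<dots> = (\<Otimes>x\<in>?S. if odd m then x else \<one>)"
      using that(2) by (intro finprod_cong') (auto simp: pow_if_square_one sq)
    also have "\<dots> = (if odd m then \<Otimes>x\<in>?S. x else \<one>)"
      by (simp add: finprod_one_eqI)
    finally show ?thesis .
  qed
  have "(\<exists>xs. length xs = n \<and> set xs \<subseteq> carrier G \<and>
      (\<forall>x. 2 * count_list xs x = (if x \<in> ?S then lam else 0)) \<and>
      foldl (\<otimes>) \<one> xs \<noteq> \<one>) \<longleftrightarrow>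
    (\<exists>m. lam = 2 * m \<and> n = m * (order G - t) \<and> odd m \<and> (\<Otimes>x\<in>?S. x) \<noteq> \<one>)"
    (is "(\<exists>xs. ?P xs) \<longleftrightarrow> (\<exists>m. ?Q m)")
  proof
    assume "\<exists>xs. ?P xs"
    then obtain xs where len: "length xs = n" and ne: "foldl (\<otimes>) \<one> xs \<noteq> \<one>"
      and cnt: "\<And>x. 2 * count_list xs x = (if x \<in> ?S then lam else 0)"
      by metis
    \<comment> \<open>Properness of \<open>J\<close> gives an element whose doubled count is
      \<open>lam\<close>, so \<open>lam\<close> is even.\<close>
    obtain y where "y \<in> ?S"
      using J(3) JG by blast
    then obtain m where m: "lam = 2 * m"
      using cnt[of y] by auto
    have sub: "set xs \<subseteq> ?S"
    proof
      fix x assume "x \<in> set xs"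
      then have "count_list xs x \<noteq> 0" by (simp add: count_list_0_iff)
      then show "x \<in> ?S" using cnt[of x] by (auto split: if_splits)
    qed
    have cm: "count_list xs x = m" if "x \<in> ?S" for x
      using cnt[of x] that m by auto
    have "n = (\<Sum>x\<in>?S. count_list xs x)"
      using sum_count_set[OF sub S(1)] len by simp
    also have "\<dots> = m * (order G - t)"
      using cm card_S by simp
    finally show "\<exists>m. ?Q m"
      using m ne sum_eq[OF sub cm] by (auto split: if_splits)
  next
    assume "\<exists>m. ?Q m"
    then obtain m where m: "lam = 2 * m" "n = m * (order G - t)" "odd m" "(\<Otimes>x\<in>?S. x) \<noteq> \<one>"
      by blast
    obtain xs where xs: "set xs \<subseteq> ?S" "length xs = m * card ?S"
      "\<And>x. count_list xs x = (if x \<in> ?S then m else 0)"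
      using ex_list_const_count[OF S(1)] by blast
    have "count_list xs x = m" if "x \<in> ?S" for x
      using xs(3) that by simp
    then have "?P xs"
      using m xs card_S sum_eq[OF xs(1), of m] by auto
    then show "\<exists>xs. ?P xs" ..
  qed
  then show ?thesis
    using ex_row_NH_iff_ex_list[OF sq J(1,2)] by simp
qed

section \<open>The product over the complement of a subgroup\<close>

text \<open>The product is a power of some \<open>a \<noteq> \<one>\<close>, trivial exactly when
  the exponent is even. The exponent is \<open>2 ^ (r - 1)\<close> for \<open>s = 0\<close> and
  \<open>2 ^ (r - 1) - 2 ^ (s - 1)\<close> for \<open>s > 0\<close>.\<close>

lemma (in comm_group) finprod_Diff_subgroup_eq_one_iff:
  assumes sq: "\<And>x. x \<in> carrier G \<Longrightarrow> x \<otimes> x = \<one>"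
    and J: "subgroup J G" "card J = 2 ^ s" and v: "order G = 2 ^ r" and less: "s < r"
  shows "(\<Otimes>x\<in>carrier G - J. x) = \<one> \<longleftrightarrow> s \<noteq> 1 \<and> r \<noteq> 1"
proof -
  \<comment> \<open>An infinite carrier would have \<open>card\<close> equal to 0, which is no power
    of 2.\<close>
  have fin: "finite (carrier G)"
    using v by (metis card.infinite order_def power_not_zero zero_neq_numeral)
  have JG: "J \<subseteq> carrier G" and oneJ: "\<one> \<in> J"
    using J(1) by (auto simp: subgroup.subset subgroup.one_closed)
  have pow: "a [^] (k::nat) = \<one> \<longleftrightarrow> even k" if "a \<in> carrier G" "a \<noteq> \<one>" for a k
    using that by (simp add: pow_if_square_one sq)
  show ?thesis
  proof (cases s)
    case 0
    then have J1: "J = {\<one>}"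
      using J(2) oneJ by (auto simp: card_1_singleton_iff)
    have "carrier G \<noteq> {\<one>}"
      using one_less_power[of "2 :: nat" r] v less by (auto simp: order_def)
    then obtain a where a: "a \<in> carrier G" "a \<noteq> \<one>"
      using one_closed by blast
    \<comment> \<open>Translation by \<open>a\<close> sends \<open>a\<close> to
      \<open>\<one>\<close>, so the complement of \<open>{\<one>}\<close> is not closed; adding the
      neutral factor \<open>\<one>\<close> repairs this.\<close>
    have "(\<Otimes>x\<in>carrier G - J. x) = (\<Otimes>x\<in>carrier G. x)"
      unfolding J1 by (rule finprod_mono_neutral_cong_left) (use fin in auto)
    also have "\<dots> = a [^] (2 ^ r div 2 :: nat)"
      using finprod_translation_closed[OF sq a fin] a v by (simp add: order_def)
    also have "2 ^ r div 2 = (2 :: nat) ^ (r - 1)"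
      using less by (cases r) auto
    finally show ?thesis using a less 0 by (auto simp: pow)
  next
    case (Suc s')
    have "J \<noteq> {\<one>}"
      using J Suc by auto
    then obtain a where a: "a \<in> J" "a \<noteq> \<one>"
      using oneJ by blast
    then have ac: "a \<in> carrier G" using JG by blast
    have closed: "a \<otimes> x \<in> carrier G - J" if "x \<in> carrier G - J" for x
    proof -
      have "x = a \<otimes> (a \<otimes> x)"
        using sq[OF ac] ac that by (simp flip: m_assoc)
      then have "a \<otimes> x \<notin> J"
        using that a(1) subgroup.m_closed[OF J(1)] by (metis DiffD2)
      then show ?thesis using that ac by auto
    qed
    have "(\<Otimes>x\<in>carrier G - J. x) = a [^] (card (carrier G - J) div 2)"
      using finprod_translation_closed[OF sq ac a(2) _ _ closed] fin by auto
    also have "card (carrier G - J) = 2 ^ r - 2 ^ s"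
      using JG J(2) v fin by (simp add: card_Diff_subset finite_subset order_def)
    also have "(2 ^ r - 2 ^ s :: nat) div 2 = 2 ^ (r - 1) - 2 ^ s'"
      using less Suc by (cases r) (auto simp flip: diff_mult_distrib2)
    \<comment> \<open>Here \<open>0 < s < r\<close>, so \<open>2 ^ (r - 1)\<close> is even and the
      exponent is odd exactly when \<open>s' = 0\<close>.\<close>
    finally show ?thesis
      using less Suc ac a(2) by (auto simp: pow)
  qed
qed

theorem theorem2p3:
  fixes G :: "('a, 'b) monoid_scheme" and J :: "'a set"
    and r r1 v t lam n :: nat
  assumes "group G" and "G \<cong> Z2_power r" and "order G = v" and "v = 2 ^ r"
    and "subgroup J G" and "J \<noteq> carrier G"
    and "G\<lparr>carrier := J\<rparr> \<cong> Z2_power r1" and "card J = t" and "t = 2 ^ r1"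
    and "lam > 0" and "n > 0"
  shows "(\<exists>A. is_row_NH G J lam t n A) \<longleftrightarrow>
    real v = 2 * real n / real lam + real t \<and> even lam \<and>
    ((t = 2 \<and> (\<exists>c. odd c \<and> n = c * (v - t))) \<or> (v = 2 \<and> odd n))"
proof -
  interpret group G by (rule assms)
  have sq: "x \<otimes>\<^bsub>G\<^esub> x = \<one>\<^bsub>G\<^esub>" if "x \<in> carrier G" for x
    using square_one_if_iso_Z2_power[OF assms(2) that] .
  interpret comm_group G by (rule comm_group_if_square_one[OF sq])
  have fin: "finite (carrier G)"
    using assms(3,4) by (metis card.infinite order_def power_not_zero zero_neq_numeral)
  have "card J < order G"
    using psubset_card_mono[OF fin] subgroup.subset[OF assms(5)] assms(6)
    by (auto simp: order_def)
  then have less: "r1 < r" "t < v"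
    using assms(3,4,8,9) by auto
  have "(\<Otimes>\<^bsub>G\<^esub>x\<in>carrier G - J. x) \<noteq> \<one>\<^bsub>G\<^esub> \<longleftrightarrow> r1 = 1 \<or> r = 1"
    using finprod_Diff_subgroup_eq_one_iff[OF sq assms(5), of r1 r] assms less by auto
  also have "\<dots> \<longleftrightarrow> t = 2 \<or> v = 2"
    using assms(4,9) power_inject_exp[of "2::nat" _ 1] by auto
  finally have *: "(\<Otimes>\<^bsub>G\<^esub>x\<in>carrier G - J. x) \<noteq> \<one>\<^bsub>G\<^esub> \<longleftrightarrow> t = 2 \<or> v = 2" .
  \<comment> \<open>In this case \<open>v - t = 1\<close>, so \<open>m\<close> equals
    \<open>n\<close> and its oddness becomes that of \<open>n\<close>.\<close>
  have t1: "t = 1" if "v = 2"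
    using that less assms(9) by (cases r1) auto
  \<comment> \<open>Clearing the denominator uses \<open>lam > 0\<close>; \<open>t < v\<close> makes
    the natural subtraction exact.\<close>
  have "real v = 2 * real n / real lam + real t \<longleftrightarrow> real (lam * (v - t)) = real (2 * n)"
    using less \<open>lam > 0\<close> by (auto simp: field_simps of_nat_diff)
  then have **: "real v = 2 * real n / real lam + real t \<longleftrightarrow> lam * (v - t) = 2 * n"
    by (simp only: of_nat_eq_iff)
  have "(\<exists>A. is_row_NH G J lam t n A) \<longleftrightarrow>
      (\<exists>m. lam = 2 * m \<and> n = m * (v - t) \<and> odd m \<and> (t = 2 \<or> v = 2))"
    using ex_row_NH_iff_finprod[OF sq assms(5,8,6) fin, of lam n] assms(3) * by simp
  \<comment> \<open>For \<open>t = 2\<close> the odd multiplier \<open>c\<close> must be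
    \<open>m\<close>, by cancelling \<open>v - t > 0\<close>.\<close>
  also have "\<dots> \<longleftrightarrow> lam * (v - t) = 2 * n \<and> even lam \<and>
    ((t = 2 \<and> (\<exists>c. odd c \<and> n = c * (v - t))) \<or> (v = 2 \<and> odd n))"
    using less t1 by (auto elim!: evenE)
  finally show ?thesis unfolding ** .
qed

end
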